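(* For every $\ell\in\mathbb N_+$ there is a function $\eta_\ell(n,\epsilon)$ with the property that for every $\alpha>0$ there is $\epsilon_0>0$ such that for every $\epsilon\in(0,\epsilon_0)$ there is $n_0\in\mathbb N$ with $|\eta_\ell(n,\epsilon)|<\alpha$ for all $n\ge n_0$, and such that the following holds: for every $\epsilon\in(0,1/2)$ and every $n\in\mathbb N_+$, there exists a graph $G$ with $|G|=n$ and $\mathrm{Lit}(G)\le\ell$ such that every $\epsilon$-good partition of $G$ has size at least $$\bigl(1+\eta_\ell(n,\epsilon)\bigr)\cdot\epsilon^{-\ell}.$$
   Context: Graphs are finite, simple, undirected; $|G|=|V(G)|$; $N^1_G(v)=N_G(v)$ and $N^0_G(v)=V(G)\setminus N_G(v)$. $\mathrm{Lit}(G)$ is the largest $t\in\mathbb N$ for which there are vertices $x_\sigma$ ($\sigma\in\{0,1\}^{<t}$, binary strings of length less than $t$) and $w_\tau$ ($\tau\in\{0,1\}^t$) of $G$ such that for all $\tau\in\{0,1\}^t$ and $i\in[t]$: $x_{\tau|_{[i-1]}}\in N_G(w_\tau)\iff\tau_i=1$. A non-empty $U\subseteq V(G)$ is $\epsilon$-good in $G$ if for every $v\in V(G)$ there is $b\in\{0,1\}$ with $|N_G^b(v)\cap U|\ge(1-\epsilon)|U|$. An $\epsilon$-good partition of $G$ is a partition of $V(G)$ all of whose parts are $\epsilon$-good in $G$; its size is its number of parts. *)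

theory Defs
  imports Complex_Main "HOL-Library.Disjoint_Sets" "Graph_Theory.Pair_Digraph"
begin

(* Finite simple undirected graphs are the locale pair_graph: a finite, loop-free digraph on
   pairs whose arc relation is symmetric. *)

definition nbhd :: "'a pair_pre_digraph \<Rightarrow> 'a \<Rightarrow> 'a set" where
  "nbhd G v = {u \<in> pverts G. (v, u) \<in> parcs G}"

(* N^1_G(v) = N_G(v) for b = True; N^0_G(v) = V(G) - N_G(v), which contains v, for b = False. *)
definition nbhd_val :: "'a pair_pre_digraph \<Rightarrow> bool \<Rightarrow> 'a \<Rightarrow> 'a set" where
  "nbhd_val G b v = (if b then nbhd G v else pverts G - nbhd G v)"

(* Binary strings are bool lists, True standing for the digit 1. The list index is 0-based, so
   tau_i is \<tau> ! (i - 1), and the restriction of tau to [i-1] is take (i - 1) \<tau>.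
   The vertices need not be distinct. *)
definition has_littlestone_tree :: "'a pair_pre_digraph \<Rightarrow> nat \<Rightarrow> bool" where
  "has_littlestone_tree G t \<longleftrightarrow>
     (\<exists>(x :: bool list \<Rightarrow> 'a) (w :: bool list \<Rightarrow> 'a).
        (\<forall>\<sigma>. length \<sigma> < t \<longrightarrow> x \<sigma> \<in> pverts G) \<and>
        (\<forall>\<tau>. length \<tau> = t \<longrightarrow> w \<tau> \<in> pverts G) \<and>
        (\<forall>\<tau>. length \<tau> = t \<longrightarrow>
           (\<forall>i\<in>{1..t}. x (take (i - 1) \<tau>) \<in> nbhd G (w \<tau>) \<longleftrightarrow> \<tau> ! (i - 1))))"

(* For a finite non-empty graph the maximum exists: t = 0 always qualifies, and the w \<tau> are
   pairwise distinct, so 2^t is at most the number of vertices. *)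
definition Lit :: "'a pair_pre_digraph \<Rightarrow> nat" where
  "Lit G = (GREATEST t. has_littlestone_tree G t)"

definition good_set :: "real \<Rightarrow> 'a pair_pre_digraph \<Rightarrow> 'a set \<Rightarrow> bool" where
  "good_set \<epsilon> G U \<longleftrightarrow>
     U \<noteq> {} \<and> U \<subseteq> pverts G \<and>
     (\<forall>v\<in>pverts G. \<exists>b. real (card (nbhd_val G b v \<inter> U)) \<ge> (1 - \<epsilon>) * real (card U))"

definition good_partition :: "real \<Rightarrow> 'a pair_pre_digraph \<Rightarrow> 'a set set \<Rightarrow> bool" where
  "good_partition \<epsilon> G P \<longleftrightarrow> partition_on (pverts G) P \<and> (\<forall>U\<in>P. good_set \<epsilon> G U)"

end

(* Take a k-ary tree of depth l, with k just below 1/eps, attach a large class of new vertices to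
   each of its k^l leaves, and join every new vertex to its l ancestors below the root. A large
   eps-good set U is almost contained in a single class: if a tree node carries at least (1 - eps)|U|
   of U, then k eps < 1 - eps rules out that each child carries at most eps|U|, so by goodness some
   child carries at least (1 - eps)|U|. Hence the classes dominating no part of a good partition
   have only about eps n elements altogether, i.e. there are about eps k^l of them, and the
   remaining ones dominate distinct parts.
   A Littlestone tree of height t contains, along its all-ones branch, a half graph with two adjacent
   vertices of degree at least t. Since the graph is bipartite and the new vertices have
   degree l, this forces t <= l. *)
theory Submission
  imports Defs
begin

section \<open>Littlestone trees and degrees\<close>

lemma littlestone_tree_degrees:
  assumes T: "has_littlestone_tree G t" and "t \<ge> 1" and fin: "finite (pverts G)"
    and sym: "\<And>u v. (u, v) \<in> parcs G \<Longrightarrow> (v, u) \<in> parcs G"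
  obtains u v where "v \<in> nbhd G u" "u \<in> pverts G" "t \<le> card (nbhd G u)" "t \<le> card (nbhd G v)"
proof -
  obtain x w where x: "\<And>\<sigma>. length \<sigma> < t \<Longrightarrow> x \<sigma> \<in> pverts G"
    and w: "\<And>\<tau>. length \<tau> = t \<Longrightarrow> w \<tau> \<in> pverts G"
    and xw: "\<And>\<tau> i. length \<tau> = t \<Longrightarrow> i \<in> {1..t} \<Longrightarrow>
      (x (take (i - 1) \<tau>) \<in> nbhd G (w \<tau>)) = \<tau> ! (i - 1)"
    using T unfolding has_littlestone_tree_def by blast
  \<comment> \<open>\<open>X i\<close> runs along the all-ones branch, and \<open>W j\<close> is the
    leaf whose path leaves it after \<open>j\<close> ones. Adjacency is known only for
    \<open>i\<close> \<le> \<open>j\<close>, which suffices for the degrees of \<open>X 0\<close>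
    and \<open>W t\<close>.\<close>
  define X where "X i = x (replicate i True)" for i
  define W where "W j = w (replicate j True @ replicate (t - j) False)" for j
  have XW: "X i \<in> nbhd G (W j) \<longleftrightarrow> i < j" if "i \<le> j" "j \<le> t" "i < t" for i j
    using xw[of "replicate j True @ replicate (t - j) False" "Suc i"] that
    unfolding X_def W_def by (auto simp: nth_append min_def)
  have Wv: "W j \<in> pverts G" if "j \<le> t" for j
    using that w unfolding W_def by simp
  have Xv: "X i \<in> pverts G" if "i < t" for i
    using that x unfolding X_def by simp
  have nb_sym: "v \<in> nbhd G u" if "u \<in> nbhd G v" "v \<in> pverts G" for u v
    using that sym unfolding nbhd_def by auto
  have nb_fin: "finite (nbhd G u)" for u
    using fin unfolding nbhd_def by simp
  \<comment> \<open>For \<open>i < j\<close>, \<open>W j\<close> tells \<open>X i\<close> from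
    \<open>X j\<close>; below, \<open>X i\<close> likewise tells \<open>W i\<close> from
    \<open>W j\<close>.\<close>
  have "inj_on X {..<t}"
  proof (rule linorder_inj_onI)
    fix i j assume "i < j" "i \<in> {..<t}" "j \<in> {..<t}"
    then have "X i \<in> nbhd G (W j)" "X j \<notin> nbhd G (W j)"
      using XW[of i j] XW[of j j] by auto
    then show "X i \<noteq> X j" by auto
  qed auto
  moreover have "X ` {..<t} \<subseteq> nbhd G (W t)"
    using XW[of _ t] by auto
  ultimately have deg_W: "t \<le> card (nbhd G (W t))"
    using card_inj_on_le[OF _ _ nb_fin] by fastforce
  have "inj_on W {1..t}"
  proof (rule linorder_inj_onI)
    fix i j assume "i < j" "i \<in> {1..t}" "j \<in> {1..t}"
    then have "X i \<in> nbhd G (W j)" "X i \<notin> nbhd G (W i)"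
      using XW[of i j] XW[of i i] by auto
    then show "W i \<noteq> W j" by auto
  qed auto
  moreover have "W ` {1..t} \<subseteq> nbhd G (X 0)"
    using XW[of 0] Wv nb_sym \<open>t \<ge> 1\<close> by auto
  ultimately have deg_X: "t \<le> card (nbhd G (X 0))"
    using card_inj_on_le[OF _ _ nb_fin] by fastforce
  show thesis
    using that[of "X 0" "W t"] XW[of 0 t] deg_W deg_X Wv[of t] \<open>t \<ge> 1\<close>
      nb_sym[of "X 0" "W t"] Xv[of 0] by auto
qed

lemma Lit_le:
  assumes "\<And>t. has_littlestone_tree G t \<Longrightarrow> t \<le> l" and "pverts G \<noteq> {}"
  shows "Lit G \<le> l"
proof -
  \<comment> \<open>\<open>GREATEST\<close> is attained only if some height qualifies; one vertex as
    the sole leaf gives height 0.\<close>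
  obtain v where "v \<in> pverts G" using assms(2) by auto
  then have "has_littlestone_tree G 0"
    unfolding has_littlestone_tree_def by (intro exI[of _ "\<lambda>_. v"]) simp
  then have "has_littlestone_tree G (Lit G)"
    unfolding Lit_def using assms(1) by (rule GreatestI_nat)
  then show ?thesis by (rule assms(1))
qed

section \<open>The tree graph\<close>

(* The class of a vertex v >= l * k^l is v mod k^l. For j < l and q < k^(l - j), the vertex
   j * k^l + q is the tree node at height j whose subtree contains the classes c with
   c div k^j = q. The vertices below l * k^l not of this form are isolated. *)
definition tree_adj :: "nat \<Rightarrow> nat \<Rightarrow> nat \<Rightarrow> nat \<Rightarrow> bool" where
  "tree_adj k l u v \<longleftrightarrow>
     u < l * k^l \<and> l * k^l \<le> v \<and> (v mod k^l) div k^(u div k^l) = u mod k^l"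

definition tree_graph :: "nat \<Rightarrow> nat \<Rightarrow> nat \<Rightarrow> nat pair_pre_digraph" where
  "tree_graph k l n =
     \<lparr>pverts = {..<n}, parcs = {(u, v). u < n \<and> v < n \<and> (tree_adj k l u v \<or> tree_adj k l v u)}\<rparr>"

lemma pverts_tree_graph [simp]: "pverts (tree_graph k l n) = {..<n}"
  by (simp add: tree_graph_def)

lemma tree_graph_pair_graph: "pair_graph (tree_graph k l n)"
proof
  have "\<not> tree_adj k l u u" for u
    by (auto simp: tree_adj_def)
  then show "\<And>e. e \<in> parcs (tree_graph k l n) \<Longrightarrow> fst e \<noteq> snd e"
    by (auto simp: tree_graph_def)
  show "symmetric (with_proj (tree_graph k l n))"
    by (auto simp: tree_graph_def symmetric_def arcs_ends_def arc_to_ends_def sym_def)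
  show "finite (parcs (tree_graph k l n))"
    by (rule finite_subset[of _ "{..<n} \<times> {..<n}"]) (auto simp: tree_graph_def)
qed (auto simp: tree_graph_def)

lemma nbhd_tree_graph:
  assumes "u < n"
  shows "nbhd (tree_graph k l n) u = {v. v < n \<and> (tree_adj k l u v \<or> tree_adj k l v u)}"
  using assms by (auto simp: nbhd_def tree_graph_def)

text \<open>Adjacency determines \<open>u mod k^l\<close> from the height \<open>u div k^l\<close>,
  so \<open>v\<close> has at most one neighbour at each of the \<open>l\<close> heights.\<close>

lemma card_nbhd_class_le:
  assumes "l * k^l \<le> v" "v < n"
  shows "card (nbhd (tree_graph k l n) v) \<le> l"
proof -
  have nb: "nbhd (tree_graph k l n) v \<subseteq> {u. tree_adj k l u v}"
    using assms by (auto simp: nbhd_tree_graph tree_adj_def)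
  have "inj_on (\<lambda>u. u div k^l) {u. tree_adj k l u v}"
    by (rule inj_onI) (metis (mono_tags, lifting) div_mult_mod_eq mem_Collect_eq tree_adj_def)
  moreover have "(\<lambda>u. u div k^l) ` {u. tree_adj k l u v} \<subseteq> {..<l}"
    by (auto simp: tree_adj_def less_mult_imp_div_less)
  ultimately have "card (nbhd (tree_graph k l n) v) \<le> card {..<l}"
    by (intro card_inj_on_le[where f = "\<lambda>u. u div k^l"]) (use nb in \<open>auto intro: inj_on_subset\<close>)
  then show ?thesis by simp
qed

lemma Lit_tree_graph:
  assumes "n \<ge> 1"
  shows "Lit (tree_graph k l n) \<le> l"
proof (rule Lit_le)
  let ?G = "tree_graph k l n"
  fix t assume T: "has_littlestone_tree ?G t"
  show "t \<le> l"
  proof (cases "t = 0")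
    case False
    then have "t \<ge> 1" "finite (pverts ?G)"
      "\<And>u v. (u, v) \<in> parcs ?G \<Longrightarrow> (v, u) \<in> parcs ?G"
      by (auto simp: tree_graph_def)
    then obtain u v where "v \<in> nbhd ?G u" "u \<in> pverts ?G"
      and deg: "t \<le> card (nbhd ?G u)" "t \<le> card (nbhd ?G v)"
      using littlestone_tree_degrees[OF T] by metis
    then have "u < n" "v < n" "tree_adj k l u v \<or> tree_adj k l v u"
      by (auto simp: nbhd_tree_graph)
    then have "card (nbhd ?G u) \<le> l \<or> card (nbhd ?G v) \<le> l"
      using card_nbhd_class_le[of l k] by (auto simp: tree_adj_def)
    then show ?thesis using deg by auto
  qed simp
qed (use assms in \<open>simp add: lessThan_empty_iff\<close>)

section \<open>Good partitions of the tree graph\<close>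

definition tree_class :: "nat \<Rightarrow> nat \<Rightarrow> nat \<Rightarrow> nat \<Rightarrow> nat set" where
  "tree_class k l n c = {v. l * k^l \<le> v \<and> v < n \<and> v mod k^l = c}"

text \<open>Neighbours and non-neighbours of \<open>v\<close> split \<open>U\<close>, so the choice
  \<open>b = False\<close> becomes an upper bound on the neighbours.\<close>

lemma good_set_dichotomy:
  assumes "good_set \<epsilon> G U" "v \<in> pverts G" "finite (pverts G)"
  shows "real (card (nbhd G v \<inter> U)) \<le> \<epsilon> * real (card U)
    \<or> real (card (nbhd G v \<inter> U)) \<ge> (1 - \<epsilon>) * real (card U)"
proof -
  have U: "U \<subseteq> pverts G" and fin: "finite U"
    using assms finite_subset unfolding good_set_def by auto
  obtain b where b: "real (card (nbhd_val G b v \<inter> U)) \<ge> (1 - \<epsilon>) * real (card U)"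
    using assms unfolding good_set_def by auto
  show ?thesis
  proof (cases b)
    case False
    have "(pverts G - nbhd G v) \<inter> U = U - nbhd G v \<inter> U"
      using U by auto
    then have "card ((pverts G - nbhd G v) \<inter> U) + card (nbhd G v \<inter> U) = card U"
      using fin by (simp add: card_Diff_subset card_mono)
    then show ?thesis using b False by (simp add: nbhd_val_def algebra_simps)
  qed (use b in \<open>simp add: nbhd_val_def\<close>)
qed

text \<open>Descent from the root to a leaf. \<open>large\<close> serves twice: the at most
  \<open>l * k^l\<close> vertices of \<open>U\<close> outside all classes cost only an \<epsilon>
  fraction at the root, and \<open>l * k^l\<close> \<le> \<open>n\<close> follows, so every tree
  node below the root is a vertex.\<close>

lemma large_good_set_dominated:
  fixes \<epsilon> :: real
  assumes good: "good_set \<epsilon> (tree_graph k l n) U"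
    and \<epsilon>: "0 < \<epsilon>" "(real k + 1) * \<epsilon> < 1" and k: "k \<ge> 1"
    and large: "real (l * k^l) \<le> \<epsilon> * real (card U)"
  obtains c where "c < k^l" "real (card (tree_class k l n c \<inter> U)) \<ge> (1 - \<epsilon>) * real (card U)"
proof -
  let ?a = "l * k^l"
  have U: "U \<subseteq> {..<n}" "U \<noteq> {}"
    using good unfolding good_set_def by auto
  have fin: "finite U" using U finite_subset by blast
  then have pos: "card U > 0" using U by auto
  have "\<epsilon> < 1"
    using \<epsilon> by (simp add: algebra_simps) (smt (verit) mult_nonneg_nonneg of_nat_0_le_iff)
  have "real ?a \<le> real (card U)"
    using large \<open>\<epsilon> < 1\<close> mult_right_mono[of \<epsilon> 1 "real (card U)"] by linarith
  moreover have "card U \<le> n" using card_mono[OF _ U(1)] by simp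
  ultimately have an: "?a \<le> n" by linarith
  \<comment> \<open>The part of \<open>U\<close> in the classes under node \<open>q\<close> of
    height \<open>j\<close>. The root, of height \<open>l\<close>, is not a vertex, so only
    \<open>j < l\<close> gives traces of neighbourhoods.\<close>
  define S where "S j q = {v\<in>U. ?a \<le> v \<and> (v mod k^l) div k^j = q}" for j q
  have S_nbhd: "S j q = nbhd (tree_graph k l n) (j * k^l + q) \<inter> U" and v: "j * k^l + q < n"
    if "j < l" "q < k^(l - j)" for j q
  proof -
    have "k^(l - j) \<le> k^l" using k by (simp add: power_increasing)
    then have q: "q < k^l" using that by linarith
    then have "j * k^l + q < Suc j * k^l" by simp
    also have "\<dots> \<le> ?a" using that by (intro mult_right_mono) auto
    finally have lt: "j * k^l + q < ?a" .
    then show n: "j * k^l + q < n" using an by linarith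
    have "(j * k^l + q) div k^l = j" "(j * k^l + q) mod k^l = q" using q k by auto
    then show "S j q = nbhd (tree_graph k l n) (j * k^l + q) \<inter> U"
      using U lt by (auto simp: S_def nbhd_tree_graph[OF n] tree_adj_def)
  qed
  \<comment> \<open>The bound does not deteriorate on the way down: by the dichotomy, a child with
    more than an \<epsilon> fraction of \<open>U\<close> already has a 1 - \<epsilon>
    fraction.\<close>
  have "\<exists>q<k^(l - j). real (card (S j q)) \<ge> (1 - \<epsilon>) * real (card U)" if "j \<le> l" for j
    using that
  proof (induction rule: inc_induct)
    case base
    have "v mod k^l div k^l = 0" for v using k by simp
    then have "U - S l 0 \<subseteq> {..<?a}" by (auto simp: S_def)
    then have "card (U - S l 0) \<le> ?a"
      using card_mono[of "{..<?a}" "U - S l 0"] by simp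
    moreover have "card (U - S l 0) = card U - card (S l 0)" "card (S l 0) \<le> card U"
      using fin by (auto simp: S_def intro!: card_Diff_subset card_mono)
    ultimately have "real (card U) - real (card (S l 0)) \<le> real ?a"
      by linarith
    then have "real (card (S l 0)) \<ge> (1 - \<epsilon>) * real (card U)"
      using large by (simp add: algebra_simps)
    then show ?case by auto
  next
    case (step j)
    then obtain q where q: "q < k^(l - Suc j)"
      and Sq: "real (card (S (Suc j) q)) \<ge> (1 - \<epsilon>) * real (card U)" by auto
    have kk: "k^(l - j) = k^(l - Suc j) * k"
      using step.hyps by (metis Suc_diff_Suc power_Suc2)
    \<comment> \<open>The children of node \<open>q\<close> are the nodes \<open>q * k + r\<close>
      one height lower, as \<open>div k^(Suc j)\<close> is \<open>div k^j\<close> followed by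
      \<open>div k\<close>.\<close>
    have child: "q * k + r < k^(l - j)" if "r < k" for r
    proof -
      have "q * k + r < Suc q * k" using that by simp
      also have "\<dots> \<le> k^(l - Suc j) * k" using q by (intro mult_right_mono) auto
      finally show ?thesis using kk by simp
    qed
    have "\<exists>r<k. real (card (S j (q * k + r))) \<ge> (1 - \<epsilon>) * real (card U)"
    proof (rule ccontr)
      assume *: "\<not> ?thesis"
      have small: "real (card (S j (q * k + r))) \<le> \<epsilon> * real (card U)" if "r < k" for r
        using good_set_dichotomy[OF good, of "j * k^l + (q * k + r)"] *
          S_nbhd[OF _ child[OF that]] v[OF _ child[OF that]] step.hyps that by auto
      have "S (Suc j) q \<subseteq> (\<Union>r<k. S j (q * k + r))"
      proof
        fix x assume x: "x \<in> S (Suc j) q"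
        let ?y = "x mod k^l div k^j"
        have "?y div k = q" using x by (simp add: S_def div_mult2_eq[symmetric] mult.commute)
        then have "?y = q * k + ?y mod k" by (metis div_mult_mod_eq)
        then have "x \<in> S j (q * k + ?y mod k)" using x by (simp add: S_def)
        moreover have "?y mod k < k" using k by simp
        ultimately show "x \<in> (\<Union>r<k. S j (q * k + r))" by blast
      qed
      then have "card (S (Suc j) q) \<le> card (\<Union>r<k. S j (q * k + r))"
        using fin by (intro card_mono) (auto simp: S_def)
      also have "\<dots> \<le> (\<Sum>r<k. card (S j (q * k + r)))" by (rule card_UN_le) simp
      finally have "real (card (S (Suc j) q)) \<le> (\<Sum>r<k. real (card (S j (q * k + r))))"
        by (metis of_nat_le_iff of_nat_sum)
      also have "\<dots> \<le> (\<Sum>r<k. \<epsilon> * real (card U))" by (intro sum_mono small) simp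
      finally have "(1 - \<epsilon>) * real (card U) \<le> (real k * \<epsilon>) * real (card U)" using Sq by simp
      moreover have "(real k * \<epsilon>) * real (card U) < (1 - \<epsilon>) * real (card U)"
        using \<epsilon> pos by (intro mult_strict_right_mono) (auto simp: algebra_simps)
      ultimately show False by linarith
    qed
    then show ?case using child by blast
  qed
  from this[of 0] obtain c where "c < k^l" "real (card (S 0 c)) \<ge> (1 - \<epsilon>) * real (card U)"
    by auto
  moreover have "S 0 c = tree_class k l n c \<inter> U"
    using U by (auto simp: S_def tree_class_def)
  ultimately show thesis using that by metis
qed

text \<open>Each full block of \<open>k^l\<close> consecutive vertices after the first
  \<open>l\<close> blocks contains one member of the class.\<close>

lemma card_tree_class_ge:
  assumes "c < k^l"
  shows "n div k^l - l \<le> card (tree_class k l n c)"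
proof -
  let ?f = "\<lambda>i. (l + i) * k^l + c"
  have "inj_on ?f {..<n div k^l - l}"
  proof (rule inj_onI)
    fix i j assume "?f i = ?f j"
    then have "(l + i) * k^l = (l + j) * k^l" by linarith
    moreover have "0 < k^l" using assms by linarith
    ultimately show "i = j" by (metis add_left_cancel mult_cancel2 less_irrefl)
  qed
  moreover have "?f ` {..<n div k^l - l} \<subseteq> tree_class k l n c"
  proof (intro image_subsetI)
    fix i assume i: "i \<in> {..<n div k^l - l}"
    have "?f i < Suc (l + i) * k^l" using assms by simp
    also have "\<dots> \<le> (n div k^l) * k^l" using i by (intro mult_right_mono) auto
    also have "\<dots> \<le> n" by simp
    finally have "?f i < n" .
    moreover have "l * k^l \<le> ?f i" by (simp add: add_mult_distrib)
    moreover have "?f i mod k^l = c" using assms by simp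
    ultimately show "?f i \<in> tree_class k l n c" unfolding tree_class_def by blast
  qed
  moreover have "finite (tree_class k l n c)" by (simp add: tree_class_def)
  ultimately show ?thesis using card_inj_on_le by fastforce
qed

text \<open>Double counting of the union of the undominated classes. In hypothesis \<open>n\<close>,
  the first summand pays for the parts too small to be dominated, the second for the vertices
  outside the full blocks counted in each class.\<close>

lemma good_partition_tree_graph:
  fixes \<epsilon> :: real
  assumes good: "good_partition \<epsilon> (tree_graph k l n) P"
    and \<epsilon>: "0 < \<epsilon>" "\<epsilon> < 1/2" "(real k + 1) * \<epsilon> < 1" and k: "k \<ge> 1"
    and n: "real (k^l) * real (l * k^l) / \<epsilon> + 2 * \<epsilon> * real (l * k^l + k^l) < \<epsilon> * real n"
  shows "real (card P) \<ge> (1 - 2 * \<epsilon>) * real (k^l)"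
proof (cases "card P < k^l")
  case False
  then have "real (k^l) \<le> real (card P)" by simp
  moreover have "(1 - 2 * \<epsilon>) * real (k^l) \<le> 1 * real (k^l)"
    using \<epsilon> by (intro mult_right_mono) auto
  ultimately show ?thesis by linarith
next
  \<comment> \<open>Fewer than \<open>k^l\<close> parts: this also bounds the number of small
    parts.\<close>
  case True
  let ?a = "l * k^l" and ?K = "k^l" and ?C = "tree_class k l n"
  have part: "partition_on {..<n} P" and gU: "\<And>U. U \<in> P \<Longrightarrow> good_set \<epsilon> (tree_graph k l n) U"
    using good unfolding good_partition_def by auto
  have finP: "finite P" using part finite_elements by blast
  have PU: "U \<subseteq> {..<n}" "finite U" "card U > 0" if "U \<in> P" for U
  proof -
    show "U \<subseteq> {..<n}" using that part by (auto simp: partition_on_def)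
    then show "finite U" using finite_subset by blast
    then show "card U > 0" using gU[OF that] by (auto simp: good_set_def card_gt_0_iff)
  qed
  define dom where "dom c U \<longleftrightarrow> real (card (?C c \<inter> U)) \<ge> (1 - \<epsilon>) * real (card U)" for c U
  define D where "D = {c. c < ?K \<and> (\<exists>U\<in>P. dom c U)}"
  have disj: "?C c \<inter> ?C d = {}" if "c \<noteq> d" for c d
    using that by (auto simp: tree_class_def)
  \<comment> \<open>Two disjoint classes cannot both hold more than half of \<open>U\<close>. Hence
    choosing a dominated part for each class in \<open>D\<close> is injective.\<close>
  have dom_unique: "c = d" if "dom c U" "dom d U" "U \<in> P" for c d U
  proof (rule ccontr)
    assume "c \<noteq> d"
    then have "card (?C c \<inter> U) + card (?C d \<inter> U) = card ((?C c \<inter> U) \<union> (?C d \<inter> U))"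
      using disj[of c d] PU[OF that(3)] by (subst card_Un_disjoint) auto
    also have "\<dots> \<le> card U" using PU[OF that(3)] by (intro card_mono) auto
    finally have "real (card (?C c \<inter> U)) + real (card (?C d \<inter> U)) \<le> real (card U)" by linarith
    then have "2 * (1 - \<epsilon>) * real (card U) \<le> 1 * real (card U)"
      using that unfolding dom_def by linarith
    moreover have "1 * real (card U) < 2 * (1 - \<epsilon>) * real (card U)"
      using \<epsilon> PU[OF that(3)] by (intro mult_strict_right_mono) auto
    ultimately show False by linarith
  qed
  have cardD: "card D \<le> card P"
  proof -
    obtain f where f: "\<And>c. c \<in> D \<Longrightarrow> f c \<in> P \<and> dom c (f c)"
      using bchoice[of D "\<lambda>c U. U \<in> P \<and> dom c U"] by (auto simp: D_def)
    then have "inj_on f D" by (intro inj_onI) (metis dom_unique)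
    then show ?thesis using f finP by (intro card_inj_on_le) auto
  qed
  define N where "N = {..<?K} - D"
  have DK: "D \<subseteq> {..<?K}" by (auto simp: D_def)
  have cardN: "card N = ?K - card D" and DK': "card D \<le> ?K"
    using card_mono[OF _ DK] DK finite_subset[OF DK] by (auto simp: N_def card_Diff_subset)
  define W where "W = (\<Union>c\<in>N. ?C c)"
  \<comment> \<open>The first summand bounds a small part entirely; the second bounds what a large
    part has outside its dominating class, which is disjoint from \<open>W\<close>.\<close>
  have part_bound: "real (card (W \<inter> U)) \<le> real ?a / \<epsilon> + \<epsilon> * real (card U)" if "U \<in> P" for U
  proof (cases "real ?a \<le> \<epsilon> * real (card U)")
    case False
    then have "real (card U) \<le> real ?a / \<epsilon>" using \<epsilon> by (simp add: field_simps)
    moreover have "card (W \<inter> U) \<le> card U" using PU[OF that] by (intro card_mono) auto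
    moreover have "0 \<le> \<epsilon> * real (card U)" using \<epsilon> by simp
    ultimately show ?thesis by linarith
  next
    case True
    then obtain c where c: "c < ?K" "dom c U"
      unfolding dom_def by (rule large_good_set_dominated[OF gU[OF \<open>U \<in> P\<close>] \<epsilon>(1,3) k])
    then have "c \<in> D" using that by (auto simp: D_def)
    then have "c \<notin> N" by (simp add: N_def)
    then have "W \<inter> ?C c = {}" by (auto simp: W_def tree_class_def)
    then have "W \<inter> U \<subseteq> U - ?C c \<inter> U" by blast
    then have "card (W \<inter> U) \<le> card (U - ?C c \<inter> U)" using PU[OF that] by (intro card_mono) auto
    also have "\<dots> = card U - card (?C c \<inter> U)" using PU[OF that] by (intro card_Diff_subset) auto
    finally have "real (card (W \<inter> U)) \<le> real (card U) - real (card (?C c \<inter> U))"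
      using card_mono[of U "?C c \<inter> U"] PU[OF that] by auto
    then have "real (card (W \<inter> U)) \<le> \<epsilon> * real (card U)"
      using c unfolding dom_def by (simp add: algebra_simps)
    moreover have "0 \<le> real ?a / \<epsilon>" using \<epsilon> by simp
    ultimately show ?thesis by linarith
  qed
  let ?m = "n div ?K - l"
  have "card N * ?m \<le> (\<Sum>c\<in>N. card (?C c))"
    using sum_mono[of N "\<lambda>_. ?m" "\<lambda>c. card (?C c)"] card_tree_class_ge by (simp add: N_def)
  also have "\<dots> = card W"
    unfolding W_def using disj by (intro card_UN_disjoint[symmetric]) (auto simp: N_def tree_class_def)
  also have "W = (\<Union>U\<in>P. W \<inter> U)"
    using part by (auto simp: partition_on_def W_def tree_class_def)
  also have "card \<dots> \<le> (\<Sum>U\<in>P. card (W \<inter> U))" by (rule card_UN_le[OF finP])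
  finally have "real (card N * ?m) \<le> (\<Sum>U\<in>P. real (card (W \<inter> U)))"
    by (metis of_nat_le_iff of_nat_sum)
  also have "\<dots> \<le> (\<Sum>U\<in>P. real ?a / \<epsilon> + \<epsilon> * real (card U))" by (intro sum_mono part_bound)
  also have "\<dots> = real (card P) * (real ?a / \<epsilon>) + \<epsilon> * real (\<Sum>U\<in>P. card U)"
    by (simp add: sum.distrib sum_distrib_left)
  also have "(\<Sum>U\<in>P. card U) = n"
    using product_partition[OF part] PU by simp
  also have "real (card P) * (real ?a / \<epsilon>) \<le> real ?K * (real ?a / \<epsilon>)"
    using True \<epsilon> by (intro mult_right_mono) (auto simp del: of_nat_power)
  finally have upper: "real (card N) * real ?m \<le> real ?K * real ?a / \<epsilon> + \<epsilon> * real n"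
    by simp
  have Kpos: "?K > 0" using k by simp
  have "n < (n div ?K + 1) * ?K"
    using dividend_less_div_times[OF Kpos, of n] by simp
  also have "\<dots> \<le> (?m + l + 1) * ?K" by (intro mult_right_mono) auto
  also have "\<dots> = ?m * ?K + (?a + ?K)" by (simp add: algebra_simps)
  finally have nm': "n < ?m * ?K + (?a + ?K)" .
  then have nm: "real n \<le> real ?m * real ?K + real (?a + ?K)"
    by (metis less_imp_le of_nat_add of_nat_le_iff of_nat_mult)
  have mpos: "real ?m > 0"
  proof (rule ccontr)
    assume "\<not> ?thesis"
    then have "real n \<le> real (?a + ?K)" using nm by simp
    then have "\<epsilon> * real n \<le> \<epsilon> * real (?a + ?K)" using \<epsilon> by (intro mult_left_mono) auto
    moreover have "0 \<le> real ?K * real ?a / \<epsilon>" "0 \<le> \<epsilon> * real (?a + ?K)" using \<epsilon> by simp_all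
    ultimately show False using n by linarith
  qed
  \<comment> \<open>Hypothesis \<open>n\<close> puts the bound in \<open>upper\<close> below
    \<open>2 * \<epsilon> * n - 2 * \<epsilon> * (?a + ?K)\<close>, which is at most
    \<open>2 * \<epsilon> * ?K * ?m\<close>; then \<open>?m\<close> cancels.\<close>
  have "2 * \<epsilon> * real n \<le> 2 * \<epsilon> * (real ?m * real ?K + real (?a + ?K))"
    using nm \<epsilon> by (intro mult_left_mono) auto
  also have "\<dots> = (2 * \<epsilon> * real ?K) * real ?m + 2 * \<epsilon> * real (?a + ?K)"
    by (simp only: ring_distribs mult_ac)
  finally have "real (card N) * real ?m \<le> (2 * \<epsilon> * real ?K) * real ?m"
    using upper n by linarith
  then have "real (card N) \<le> 2 * \<epsilon> * real ?K" using mpos by simp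
  then have "(1 - 2 * \<epsilon>) * real ?K \<le> real (card D)"
    using cardN DK' by (simp add: algebra_simps of_nat_diff)
  then show ?thesis using cardD by linarith
qed

section \<open>Choice of the branching number and the error term\<close>

theorem corollary9p5:
  fixes l :: nat
  assumes "l \<ge> 1"
  shows "\<exists>\<eta> :: nat \<Rightarrow> real \<Rightarrow> real.
    (\<forall>\<alpha>>0. \<exists>\<epsilon>\<^sub>0>0. \<forall>\<epsilon>. 0 < \<epsilon> \<and> \<epsilon> < \<epsilon>\<^sub>0 \<longrightarrow>
        (\<exists>n\<^sub>0. \<forall>n\<ge>n\<^sub>0. \<bar>\<eta> n \<epsilon>\<bar> < \<alpha>)) \<and>
    (\<forall>\<epsilon> n. 0 < \<epsilon> \<and> \<epsilon> < 1/2 \<and> n \<ge> 1 \<longrightarrow>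
        (\<exists>G :: nat pair_pre_digraph.
           pair_graph G \<and> card (pverts G) = n \<and> Lit G \<le> l \<and>
           (\<forall>P. good_partition \<epsilon> G P \<longrightarrow>
              real (card P) \<ge> (1 + \<eta> n \<epsilon>) * \<epsilon> powi (- int l))))"
proof -
  \<comment> \<open>For \<epsilon> < 1/2, the largest integer with
    \<open>(k + 1) * \<epsilon> < 1\<close>, strict even if 1/\<epsilon> is an integer; it is at
    least 1 since 1/\<epsilon> > 2.\<close>
  define k :: "real \<Rightarrow> nat" where "k \<epsilon> = nat (\<lceil>1 / \<epsilon>\<rceil> - 2)" for \<epsilon>
  define large where "large n \<epsilon> \<longleftrightarrow>
    real (k \<epsilon>^l) * real (l * k \<epsilon>^l) / \<epsilon> + 2 * \<epsilon> * real (l * k \<epsilon>^l + k \<epsilon>^l) < \<epsilon> * real n"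
    for n :: nat and \<epsilon>
  \<comment> \<open>One factor \<open>1 - 2 * \<epsilon>\<close> is lost to undominated classes and
    \<open>l\<close> more to rounding in \<open>(k * \<epsilon>)^l\<close>; Bernoulli's inequality
    linearises the product. For smaller \<open>n\<close>, the value -1 makes the bound 0.\<close>
  define \<eta> where "\<eta> n \<epsilon> = (if large n \<epsilon> then - 2 * real (l + 1) * \<epsilon> else -1)" for n \<epsilon>
  show ?thesis
  proof (intro exI[of _ \<eta>] conjI allI impI)
    fix \<alpha> :: real assume "\<alpha> > 0"
    have "\<exists>n\<^sub>0. \<forall>n\<ge>n\<^sub>0. \<bar>\<eta> n \<epsilon>\<bar> < \<alpha>" if \<epsilon>: "0 < \<epsilon>" "\<epsilon> < \<alpha> / (2 * real (l + 1))" for \<epsilon>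
    proof -
      \<comment> \<open>For fixed \<epsilon> the left side of \<open>large\<close> does not depend
        on \<open>n\<close>.\<close>
      obtain n\<^sub>0 where n\<^sub>0: "real (k \<epsilon>^l) * real (l * k \<epsilon>^l) / \<epsilon> + 2 * \<epsilon> * real (l * k \<epsilon>^l + k \<epsilon>^l) < real n\<^sub>0 * \<epsilon>"
        using reals_Archimedean3[OF \<epsilon>(1)] by blast
      have "large n \<epsilon>" if "n \<ge> n\<^sub>0" for n
        using n\<^sub>0 that \<open>0 < \<epsilon>\<close> mult_left_mono[of "real n\<^sub>0" "real n" \<epsilon>]
        unfolding large_def by (simp only: mult.commute[of _ \<epsilon>]) linarith
      moreover have "\<bar>- 2 * real (l + 1) * \<epsilon>\<bar> < \<alpha>"
        using \<epsilon> by (simp add: pos_less_divide_eq abs_mult mult.commute add.commute)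
      ultimately show ?thesis unfolding \<eta>_def by auto
    qed
    then show "\<exists>\<epsilon>\<^sub>0>0. \<forall>\<epsilon>. 0 < \<epsilon> \<and> \<epsilon> < \<epsilon>\<^sub>0 \<longrightarrow> (\<exists>n\<^sub>0. \<forall>n\<ge>n\<^sub>0. \<bar>\<eta> n \<epsilon>\<bar> < \<alpha>)"
      using \<open>\<alpha> > 0\<close> by (intro exI[of _ "\<alpha> / (2 * real (l + 1))"]) auto
  next
    fix \<epsilon> :: real and n :: nat
    assume "0 < \<epsilon> \<and> \<epsilon> < 1/2 \<and> n \<ge> 1"
    then have \<epsilon>: "0 < \<epsilon>" "\<epsilon> < 1/2" and "n \<ge> 1" by auto
    have "1 / \<epsilon> > 2" using \<epsilon> by (simp add: field_simps)
    then have "int (k \<epsilon>) = \<lceil>1 / \<epsilon>\<rceil> - 2" "k \<epsilon> \<ge> 1"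
      unfolding k_def by linarith+
    then have k1: "k \<epsilon> \<ge> 1" and rk: "real (k \<epsilon>) = of_int \<lceil>1 / \<epsilon>\<rceil> - 2"
      by linarith+
    have "real (k \<epsilon>) + 1 < 1 / \<epsilon>" "1 / \<epsilon> - 2 \<le> real (k \<epsilon>)"
      using rk by linarith+
    then have k\<epsilon>: "(real (k \<epsilon>) + 1) * \<epsilon> < 1" "1 - 2 * \<epsilon> \<le> real (k \<epsilon>) * \<epsilon>"
      using \<epsilon> by (auto simp: field_simps)
    have "real (card P) \<ge> (1 + \<eta> n \<epsilon>) * \<epsilon> powi (- int l)"
      if P: "good_partition \<epsilon> (tree_graph (k \<epsilon>) l n) P" for P
    proof (cases "large n \<epsilon>")
      case True
      have "1 + \<eta> n \<epsilon> = 1 + real (Suc l) * (- 2 * \<epsilon>)" using True by (simp add: \<eta>_def algebra_simps)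
      also have "\<dots> \<le> (1 + - 2 * \<epsilon>) ^ Suc l" using \<epsilon> by (intro Bernoulli_inequality) auto
      also have "\<dots> = (1 - 2 * \<epsilon>) * (1 - 2 * \<epsilon>) ^ l" by simp
      also have "\<dots> \<le> (1 - 2 * \<epsilon>) * (real (k \<epsilon>) * \<epsilon>) ^ l"
        using \<epsilon> k\<epsilon> by (intro mult_left_mono power_mono) auto
      also have "\<dots> = (1 - 2 * \<epsilon>) * real (k \<epsilon>^l) * \<epsilon>^l" by (simp add: power_mult_distrib)
      also have "\<dots> \<le> real (card P) * \<epsilon>^l"
        using good_partition_tree_graph[OF P \<epsilon> k\<epsilon>(1) k1] True \<epsilon>
        unfolding large_def by (intro mult_right_mono) auto
      finally show ?thesis using \<epsilon> by (simp add: power_int_minus field_simps)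
    qed (simp add: \<eta>_def)
    then show "\<exists>G :: nat pair_pre_digraph.
           pair_graph G \<and> card (pverts G) = n \<and> Lit G \<le> l \<and>
           (\<forall>P. good_partition \<epsilon> G P \<longrightarrow> real (card P) \<ge> (1 + \<eta> n \<epsilon>) * \<epsilon> powi (- int l))"
      using tree_graph_pair_graph Lit_tree_graph[OF \<open>n \<ge> 1\<close>]
      by (intro exI[of _ "tree_graph (k \<epsilon>) l n"]) auto
  qed
qed

end
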